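(* The sequence $\boldsymbol{u}^{(k)}=\phi^k(\boldsymbol{u}^{(0)})$ defined by the iteration $$\boldsymbol{u}^{(k+1)}=\boldsymbol{u}^{(k)}+\boldsymbol{\Pi}^{(k)},\qquad \boldsymbol{\Pi}^{(k)}=-\Sigma G'(\boldsymbol{u}^{(k)})^T\left(G'(\boldsymbol{u}^{(k)})\,\Sigma\, G'(\boldsymbol{u}^{(k)})^T+\alpha^{(k)}Q\right)^{-1}G(\boldsymbol{u}^{(k)}),\qquad \alpha^{(k)}>0,$$ converges for $k\to\infty$ to a point on $\mathcal{M}=\{\boldsymbol{u} : G(\boldsymbol{u})=0\}$ if $\boldsymbol{u}^{(0)}$ is sufficiently near to $\mathcal{M}$.
   Context: Let $m,d,N$ be positive integers with $d\le m$. For $n=0,\dots,N-1$ let $F_n:\mathbb{R}^m\to\mathbb{R}^m$ be $\mathcal{C}^3$; these maps define the discrete deterministic model $x_{n+1}=F_n(x_n)$. For $\boldsymbol{u}=(u_0,\dots,u_N)\in(\mathbb{R}^m)^{N+1}$ define $G(\boldsymbol{u})=(G_0(\boldsymbol{u}),\dots,G_{N-1}(\boldsymbol{u}))\in\mathbb{R}^{mN}$ by $G_n(\boldsymbol{u})=u_{n+1}-F_n(u_n)$, and let $G'(\boldsymbol{u})$ be its Jacobian, i.e. the $mN\times m(N+1)$ block matrix whose $n$-th block row ($n=0,\dots,N-1$) has $-F_n'(u_n)$ in block column $n$, the identity $I$ in block column $n+1$, and zeros elsewhere. The set $\mathcal{M}=\{\boldsymbol{u}:G(\boldsymbol{u})=0\}$,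 which consists of the orbits of the model, is a manifold. Matrices: $H=\mathrm{blockdiag}(H_0,\dots,H_N)$ with $H_n\in\mathbb{R}^{d\times m}$ (linear observation operators; $H$ is assumed not to be the identity matrix); $R=\mathrm{blockdiag}(R_0,\dots,R_N)$ with $R_n\in\mathbb{R}^{d\times d}$ symmetric positive definite (observational error covariance matrices); $W=\mathrm{blockdiag}(W_0,\dots,W_N)$ with $W_n\in\mathbb{R}^{m\times m}$ symmetric positive definite; $Q=\mathrm{blockdiag}(Q_1,\dots,Q_N)$ with $Q_n\in\mathbb{R}^{m\times m}$ symmetric positive definite. The matrix $\Sigma$ is $$\Sigma=H^TRH+(I-H^TH)W(I-H^TH).$$ The map $\phi$ is the one-step map of the iteration, with the iteration index on $\alpha$ dropped: $$\phi(\boldsymbol{u})=\boldsymbol{u}-\Sigma G'(\boldsymbol{u})^T\left(G'(\boldsymbol{u})\,\Sigma\, G'(\boldsymbol{u})^T+\alpha Q\right)^{-1}G(\boldsymbol{u}),$$ and $\phi^k(\boldsymbol{u}^{(0)})$ denotes the result of $k$ successive steps started from $\boldsymbol{u}^{(0)}$.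
   Formalization: The formal statement additionally assumes that the series of 1/α^(k) diverges (true for constant or bounded α^(k)); with α^(k)>0 alone the claim fails, e.g. m=d=N=1, F=0, H=0, R=W=Q=1, α^(k)=2^k. *)

theory Defs
  imports "HOL-Analysis.Analysis"
begin

text \<open>
  Dimensions are cardinalities of finite index types: \<open>m = CARD('m)\<close>, \<open>d = CARD('d)\<close> and
  \<open>N = CARD('n)\<close>, so all three are positive.  The block rows \<open>0, \<dots>, N-1\<close> are labelled by \<open>'n\<close>, the
  times \<open>0, \<dots>, N\<close> by \<open>'n option\<close>, which has \<open>N+1\<close> elements.  Each finite type is identified with
  an initial segment of the natural numbers by a fixed enumeration: \<open>pos\<close> is a bijection onto
  \<open>{..<CARD('k)}\<close> and \<open>at_pos\<close> is its inverse there.  The families \<open>F, H, R, W, Q\<close> are indexed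
  by natural numbers, and only the values in the stated index ranges matter.
\<close>

definition pos :: "'k::finite \<Rightarrow> nat"
  where "pos = to_nat_on UNIV"

definition at_pos :: "nat \<Rightarrow> 'k::finite"
  where "at_pos = from_nat_into UNIV"

lemma bij_betw_pos: "bij_betw (pos :: 'k::finite \<Rightarrow> nat) UNIV {..<CARD('k)}"
  unfolding pos_def by (rule to_nat_on_finite) simp

lemma at_pos_pos [simp]: "at_pos (pos k) = (k :: 'k::finite)"
  by (simp add: at_pos_def pos_def uncountable_infinite)

lemma pos_at_pos [simp]: "n < CARD('k) \<Longrightarrow> pos (at_pos n :: 'k::finite) = n"
  using bij_betw_pos[where 'k='k] at_pos_pos
  by (metis bij_betw_imp_surj_on imageE lessThan_iff)

type_synonym ('n, 'm) traj = "real ^ ('n option \<times> 'm)"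

definition block :: "real ^ ('k::finite \<times> 'm::finite) \<Rightarrow> 'k \<Rightarrow> real ^ 'm"
  where "block v k = (\<chi> i. v $ (k, i))"

definition state :: "('n::finite, 'm::finite) traj \<Rightarrow> nat \<Rightarrow> real ^ 'm"
  where "state u n = block u (at_pos n)"

definition blockdiag ::
  "('k::finite \<Rightarrow> real ^ 'b::finite ^ 'a::finite) \<Rightarrow> real ^ ('k \<times> 'b) ^ ('k \<times> 'a)"
  where "blockdiag A = (\<chi> p q. if fst p = fst q then A (fst p) $ snd p $ snd q else 0)"

text \<open>The identity matrix, for matrices whose row and column index types may differ.\<close>
definition is_identity :: "real ^ 'b::finite ^ 'a::finite \<Rightarrow> bool"
  where "is_identity A \<longleftrightarrow>
    CARD('a) = CARD('b) \<and> (\<forall>i j. A $ i $ j = (if pos i = pos j then 1 else 0))"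

definition sym_pos_def :: "real ^ 'a::finite ^ 'a \<Rightarrow> bool"
  where "sym_pos_def A \<longleftrightarrow> transpose A = A \<and> (\<forall>x. x \<noteq> 0 \<longrightarrow> 0 < x \<bullet> (A *v x))"

text \<open>\<open>C_diff k f\<close>: the function \<open>f\<close> is of class \<open>C\<^sup>k\<close> on the whole space; all directional
  derivatives of a differentiable function are again required to be of class \<open>C\<^sup>k\<^sup>-\<^sup>1\<close>.\<close>
primrec C_diff :: "nat \<Rightarrow> ('a::euclidean_space \<Rightarrow> 'b::euclidean_space) \<Rightarrow> bool" where
  "C_diff 0 f \<longleftrightarrow> continuous_on UNIV f"
| "C_diff (Suc k) f \<longleftrightarrow>
     (\<forall>x. f differentiable (at x)) \<and> (\<forall>v. C_diff k (\<lambda>x. frechet_derivative f (at x) v))"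

definition G ::
  "(nat \<Rightarrow> real ^ 'm \<Rightarrow> real ^ 'm) \<Rightarrow> ('n::finite, 'm::finite) traj \<Rightarrow> real ^ ('n \<times> 'm)"
  where "G F u = (\<chi> p. let n = pos (fst p) in
                    (state u (Suc n) - F n (state u n)) $ snd p)"

definition G' ::
  "(nat \<Rightarrow> real ^ 'm \<Rightarrow> real ^ 'm) \<Rightarrow> ('n::finite, 'm::finite) traj
     \<Rightarrow> real ^ ('n option \<times> 'm) ^ ('n \<times> 'm)"
  where "G' F u = jacobian (G F) (at u)"

text \<open>The block form of the Jacobian: \<open>-F\<^sub>n'(u\<^sub>n)\<close> in block column \<open>n\<close>, the identity in block
  column \<open>n+1\<close>, and zeros elsewhere.\<close>
lemma G'_blocks:
  fixes u :: "('n::finite, 'm::finite) traj"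
  assumes "\<And>n. n < CARD('n) \<Longrightarrow> F n differentiable (at (state u n))"
  shows "G' F u $ (s, i) $ (t, j) =
    (if pos t = pos s then - jacobian (F (pos s)) (at (state u (pos s))) $ i $ j
     else if pos t = Suc (pos s) then mat 1 $ i $ j else 0)"
proof -
  have lt: "pos (k::'n) < CARD('n)" for k
    using bij_betw_pos[where 'k='n] by (auto simp: bij_betw_def)
  have lin: "bounded_linear (\<lambda>v::('n,'m) traj. state v n)" for n
    unfolding linear_conv_bounded_linear[symmetric]
    by (rule linearI) (simp_all add: state_def block_def vec_eq_iff)
  define D where "D n = jacobian (F n) (at (state u n))" for n
  have dF: "(F n has_derivative (\<lambda>h. D n *v h)) (at (state u n))" if "n < CARD('n)" for n
    unfolding D_def using assms[OF that] jacobian_works by blast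
  define L where "L h = (\<chi> p::'n \<times> 'm. (state h (Suc (pos (fst p))) - D (pos (fst p)) *v state h (pos (fst p))) $ snd p)"
    for h :: "('n,'m) traj"
  have "((\<lambda>v::('n,'m) traj. (state v (Suc (pos (fst p))) - F (pos (fst p)) (state v (pos (fst p)))) $ snd p)
      has_derivative (\<lambda>h. L h $ p)) (at u)" for p :: "'n \<times> 'm"
  proof -
    have "((\<lambda>v. F (pos (fst p)) (state v (pos (fst p)))) has_derivative
        (\<lambda>h. D (pos (fst p)) *v state h (pos (fst p)))) (at u)"
      using has_derivative_compose[OF bounded_linear_imp_has_derivative[OF lin] dF[OF lt]] by simp
    then show ?thesis
      unfolding L_def vec_lambda_beta
      by (intro bounded_linear.has_derivative[OF bounded_linear_vec_nth] has_derivative_diff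
            bounded_linear_imp_has_derivative[OF lin])
  qed
  then have GL: "(G F has_derivative L) (at u)"
    unfolding has_derivative_componentwise_within[of "G F"]
    by (auto simp: Basis_vec_def G_def Let_def inner_axis)
  then have "G' F u = matrix L"
    unfolding G'_def jacobian_def using frechet_derivative_at by force
  moreover have "state (axis (t, j) (1::real) :: ('n,'m) traj) n = (if n = pos t then axis j 1 else 0)"
    if "n \<le> CARD('n)" for n
  proof -
    have "n < CARD('n option)" using that by simp
    then have "at_pos n = t \<longleftrightarrow> n = pos t"
      using pos_at_pos at_pos_pos by metis
    then show ?thesis
      by (auto simp: state_def block_def vec_eq_iff axis_def)
  qed
  moreover have "pos s \<le> CARD('n)" "Suc (pos s) \<le> CARD('n)" using lt[of s] by auto
  moreover have "(D n *v axis j 1) $ i = D n $ i $ j" for n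
    by (simp add: matrix_vector_mult_basis column_def)
  moreover have "(axis j (1::real) :: real ^ 'm) $ i = mat 1 $ i $ j"
    by (auto simp: axis_def mat_def)
  ultimately show ?thesis
    by (auto simp: matrix_def L_def D_def[symmetric])
qed

definition orbit_manifold ::
  "(nat \<Rightarrow> real ^ 'm \<Rightarrow> real ^ 'm) \<Rightarrow> ('n::finite, 'm::finite) traj set"
  where "orbit_manifold F = {u. G F u = 0}"

definition time_blockdiag ::
  "(nat \<Rightarrow> real ^ 'b ^ 'a) \<Rightarrow> real ^ ('n::finite option \<times> 'b::finite) ^ ('n option \<times> 'a::finite)"
  where "time_blockdiag A = blockdiag (\<lambda>k. A (pos k))"

text \<open>The blocks of \<open>Q\<close> are numbered \<open>1, \<dots>, N\<close>, but its block rows \<open>0, \<dots>, N-1\<close>, whence the shift.\<close>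
definition step_blockdiag ::
  "(nat \<Rightarrow> real ^ 'm ^ 'm) \<Rightarrow> real ^ ('n::finite \<times> 'm::finite) ^ ('n \<times> 'm)"
  where "step_blockdiag Q = blockdiag (\<lambda>s. Q (Suc (pos s)))"

definition Sigma_mat ::
  "real ^ 'p ^ 'q \<Rightarrow> real ^ 'q ^ 'q \<Rightarrow> real ^ 'p ^ 'p \<Rightarrow> real ^ 'p::finite ^ 'p"
  where "Sigma_mat H R W =
    transpose H ** R ** H
      + (mat 1 - transpose H ** H) ** W ** (mat 1 - transpose H ** (H :: real ^ 'p ^ 'q::finite))"

definition phi ::
  "(nat \<Rightarrow> real ^ 'm \<Rightarrow> real ^ 'm) \<Rightarrow> real ^ ('n option \<times> 'm) ^ ('n option \<times> 'm)
     \<Rightarrow> real ^ ('n \<times> 'm) ^ ('n \<times> 'm) \<Rightarrow> real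
     \<Rightarrow> ('n::finite, 'm::finite) traj \<Rightarrow> ('n, 'm) traj"
  where "phi F S Q a u =
    u - (S ** transpose (G' F u) ** matrix_inv (G' F u ** S ** transpose (G' F u) + a *\<^sub>R Q)) *v G F u"

text \<open>
  The \<open>k\<close>-th step uses its own parameter \<open>\<alpha> k\<close>; constant \<open>\<alpha>\<close> gives the iterates of a single map.
  Positivity of \<open>\<alpha>\<close> alone does not make the limit lie on the orbit manifold: for \<open>m = d = N = 1\<close>,
  \<open>F = 0\<close>, \<open>H = 0\<close>, \<open>W = Q = 1\<close> the second component of the iterate is multiplied by
  \<open>\<alpha> k / (1 + \<alpha> k)\<close> in each step, and tends to \<open>0\<close> only if the series of the \<open>1 / \<alpha> k\<close> diverges.
  This divergence holds for every bounded, in particular every constant, positive sequence.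
\<close>
primrec phi_iter ::
  "(nat \<Rightarrow> real ^ 'm \<Rightarrow> real ^ 'm) \<Rightarrow> real ^ ('n option \<times> 'm) ^ ('n option \<times> 'm)
     \<Rightarrow> real ^ ('n \<times> 'm) ^ ('n \<times> 'm) \<Rightarrow> (nat \<Rightarrow> real)
     \<Rightarrow> ('n::finite, 'm::finite) traj \<Rightarrow> nat \<Rightarrow> ('n, 'm) traj" where
  "phi_iter F S Q \<alpha> u0 0 = u0"
| "phi_iter F S Q \<alpha> u0 (Suc k) = phi F S Q (\<alpha> k) (phi_iter F S Q \<alpha> u0 k)"

end

theory Submission
  imports Defs
begin

text \<open>
  The residual is measured by \<open>V(u) = |Q\<^sup>-\<^sup>1 G(u)|\<^sub>Q\<close>, where \<open>|x|\<^sub>Q\<^sup>2 = x \<bullet> Q x\<close>.  Put \<open>A = G' \<Sigma> G'\<^sup>T\<close> and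
  \<open>w = (A + \<alpha> Q)\<^sup>-\<^sup>1 G(u)\<close>, so that the step is \<open>h = - \<Sigma> G'\<^sup>T w\<close> and \<open>G(u) + G'(u) h = \<alpha> Q w\<close>.
  Since \<open>\<Sigma>\<close> is positive definite and \<open>G'\<close> has full row rank, \<open>A \<ge> c Q\<close> near a given orbit, and the
  Cauchy-Schwarz inequality gives \<open>(\<alpha> + c) |w|\<^sub>Q \<le> V(u)\<close>.  Hence \<open>|h| \<le> C V(u) / (\<alpha> + c)\<close>, the
  linearised residual is at most \<open>(1 - c / (\<alpha> + c)) V(u)\<close>, and the linearisation error, being
  small relative to \<open>|h|\<close>, costs at most half of this gain.  So each step length is bounded by a
  constant times the decrease of \<open>V\<close>: the path has finite length, short if it starts near the orbit,
  and the iterates converge.  If \<open>V\<close> did not vanish at the limit, the decreases would force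
  \<open>\<Sum> 1 / (\<alpha>\<^sub>k + c)\<close> to be finite.
\<close>

subsection \<open>Descent sequences\<close>

text \<open>While the iterates stay in the ball,
  \<open>dist p (x k) + C / \<gamma> * V (x k)\<close> cannot increase: the decrease of
  \<open>V\<close>, weighted by \<open>C / \<gamma>\<close>, pays exactly for the length of the
  step. Hence the ball is never left, and telescoping \<open>V\<close> makes
  \<open>a k * V (x k)\<close>, and with it the step lengths, summable.\<close>

lemma descent_sequence_converges:
  fixes x :: "nat \<Rightarrow> 'a::banach" and V :: "'a \<Rightarrow> real" and a :: "nat \<Rightarrow> real"
  assumes contV: "continuous_on UNIV V" and V0: "\<And>y. 0 \<le> V y"
    and a: "\<And>k. 0 < a k" "\<And>k. \<gamma> * a k \<le> 1" "\<not> summable a"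
    and \<gamma>: "0 < \<gamma>" and C: "0 \<le> C"
    and step: "\<And>k. x k \<in> ball p r \<Longrightarrow> dist (x k) (x (Suc k)) \<le> C * a k * V (x k)"
    and decr: "\<And>k. x k \<in> ball p r \<Longrightarrow> x (Suc k) \<in> ball p r \<Longrightarrow>
                 V (x (Suc k)) \<le> (1 - \<gamma> * a k) * V (x k)"
    and start: "dist p (x 0) + C / \<gamma> * V (x 0) < r"
  shows "\<exists>l. x \<longlonglongrightarrow> l \<and> V l = 0"
proof -
  define K where "K = C / \<gamma>"
  have K: "0 \<le> K" "C = K * \<gamma>" using C \<gamma> by (auto simp: K_def)
  \<comment> \<open>This cruder bound, from \<open>\<gamma> * a k \<le> 1\<close>, comes first
    because \<open>decr\<close> applies only once the next iterate is known to lie in the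
    ball.\<close>
  have short: "C * a k * V y \<le> K * V y" for k y
  proof -
    have "K * ((\<gamma> * a k) * V y) \<le> K * (1 * V y)"
      by (intro mult_left_mono mult_right_mono a V0 K)
    then show ?thesis using K by (simp add: mult.assoc)
  qed
  have near: "dist p (x k) + K * V (x k) < r" for k
  proof (induction k)
    case 0
    then show ?case using start by (simp add: K_def)
  next
    case (Suc k)
    have xk: "x k \<in> ball p r"
    proof -
      have "0 \<le> K * V (x k)" using K V0 by simp
      then show ?thesis unfolding mem_ball using Suc.IH by linarith
    qed
    have tri: "dist p (x (Suc k)) \<le> dist p (x k) + C * a k * V (x k)"
      using dist_triangle[of p "x (Suc k)" "x k"] step[OF xk] by linarith
    then have "x (Suc k) \<in> ball p r"
      unfolding mem_ball using short[of k "x k"] Suc.IH by linarith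
    from mult_left_mono[OF decr[OF xk this] K(1)]
    have "K * V (x (Suc k)) \<le> K * V (x k) - C * a k * V (x k)"
      by (simp add: K algebra_simps)
    with tri Suc.IH show ?case by linarith
  qed
  have inb: "x k \<in> ball p r" for k
  proof -
    have "0 \<le> K * V (x k)" using K V0 by simp
    then show ?thesis unfolding mem_ball using near[of k] by linarith
  qed
  have dec: "\<gamma> * (a k * V (x k)) \<le> V (x k) - V (x (Suc k))" for k
    using decr[OF inb inb, of k] by (simp add: algebra_simps)
  have bounded: "(\<Sum>i<k. a i * V (x i)) \<le> V (x 0) / \<gamma>" for k
  proof -
    have "\<gamma> * (\<Sum>i<k. a i * V (x i)) \<le> (\<Sum>i<k. V (x i) - V (x (Suc i)))"
      unfolding sum_distrib_left by (intro sum_mono dec)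
    also have "\<dots> = V (x 0) - V (x k)"
      by (induction k) auto
    also have "\<dots> \<le> V (x 0)" using V0 by simp
    finally show ?thesis using \<gamma> by (simp add: field_simps)
  qed
  have aV: "summable (\<lambda>k. a k * V (x k))"
    using a(1) V0 by (intro summableI_nonneg_bounded[OF _ bounded]) (simp add: less_imp_le)
  have "summable (\<lambda>k. x (Suc k) - x k)"
  proof (rule summable_comparison_test')
    show "summable (\<lambda>k. C * (a k * V (x k)))" by (intro summable_mult aV)
    show "norm (x (Suc k) - x k) \<le> C * (a k * V (x k))" for k
      using step[OF inb, of k] by (simp add: dist_norm norm_minus_commute mult.assoc)
  qed
  then have "(\<lambda>k. \<Sum>i<k. x (Suc i) - x i) \<longlonglongrightarrow> (\<Sum>i. x (Suc i) - x i)"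
    by (rule summable_LIMSEQ)
  then have "(\<lambda>k. x 0 + (\<Sum>i<k. x (Suc i) - x i)) \<longlonglongrightarrow> x 0 + (\<Sum>i. x (Suc i) - x i)"
    by (intro tendsto_intros)
  then obtain l where l: "x \<longlonglongrightarrow> l"
    by (auto simp: sum_lessThan_telescope)
  have Vl: "(\<lambda>k. V (x k)) \<longlonglongrightarrow> V l"
    using contV l by (intro isCont_tendsto_compose[of l V]) (auto simp: continuous_on_eq_continuous_at)
  have "V l = 0"
  proof (rule ccontr)
    assume "V l \<noteq> 0"
    then have pos: "0 < V l" using V0[of l] by simp
    have "V (x (Suc k)) \<le> V (x k)" for k
    proof -
      have "0 \<le> \<gamma> * (a k * V (x k))" using \<gamma> a(1)[of k] V0 by simp
      then show ?thesis using dec[of k] by linarith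
    qed
    then have "V l \<le> V (x k)" for k
      by (intro decseq_ge[OF _ Vl] decseq_SucI)
    \<comment> \<open>\<open>V\<close> decreases to \<open>V l\<close> along the sequence, so the
      summable terms \<open>a k * V (x k)\<close> dominate \<open>a k * V l\<close>; dividing by
      \<open>V l\<close> would make \<open>a\<close> summable.\<close>
    then have "summable (\<lambda>k. a k * V l)"
      using a(1) pos by (intro summable_comparison_test'[OF aV]) (simp add: less_imp_le mult_left_mono)
    from summable_mult2[OF this, of "1 / V l"] show False
      using pos a(3) by simp
  qed
  with l show ?thesis by blast
qed

text \<open>A convergent shifted series has terms tending to 0, so eventually
  \<open>\<alpha> k > c\<close>; from then on \<open>1 / \<alpha> k\<close> is at most twice the
  shifted term. The sequence may thus be unbounded.\<close>

lemma not_summable_inverse_shift: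
  fixes \<alpha> :: "nat \<Rightarrow> real"
  assumes "\<And>k. 0 < \<alpha> k" "\<not> summable (\<lambda>k. 1 / \<alpha> k)" "0 < c"
  shows "\<not> summable (\<lambda>k. 1 / (\<alpha> k + c))"
proof
  assume s: "summable (\<lambda>k. 1 / (\<alpha> k + c))"
  then have "(\<lambda>k. 1 / (\<alpha> k + c)) \<longlonglongrightarrow> 0" by (rule summable_LIMSEQ_zero)
  then have "\<forall>\<^sub>F k in sequentially. 1 / (\<alpha> k + c) < 1 / (2 * c)"
    using assms(3) by (intro order_tendstoD) auto
  then have "\<forall>\<^sub>F k in sequentially. norm (1 / \<alpha> k) \<le> 2 * (1 / (\<alpha> k + c))"
  proof eventually_elim
    case (elim k)
    then show ?case using assms(1)[of k] assms(3) by (simp add: field_simps)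
  qed
  then have "summable (\<lambda>k. 1 / \<alpha> k)"
    by (rule summable_comparison_test_ev) (intro summable_mult s)
  with assms(2) show False ..
qed

subsection \<open>Matrices\<close>

lemma transpose_add: "transpose (A + B) = transpose A + transpose B"
  by (simp add: transpose_def vec_eq_iff)

lemma transpose_diff: "transpose (A - B) = transpose A - transpose B"
  by (simp add: transpose_def vec_eq_iff)

text \<open>\<open>matrix_inv\<close> is a choice that is meaningful for invertible matrices. For a
  square matrix a trivial kernel suffices, and that is what positive definiteness supplies
  directly.\<close>

lemma matrix_inv_inverse:
  fixes A :: "real ^ 'a ^ 'a"
  assumes "\<And>x. A *v x = 0 \<Longrightarrow> x = 0"
  shows "A ** matrix_inv A = mat 1" "matrix_inv A ** A = mat 1"
proof -
  have "invertible A"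
    unfolding invertible_left_inverse matrix_left_invertible_ker using assms by blast
  then show "A ** matrix_inv A = mat 1" "matrix_inv A ** A = mat 1"
    using someI_ex[of "\<lambda>B. A ** B = mat 1 \<and> B ** A = mat 1"]
    by (auto simp: matrix_inv_def invertible_def)
qed

lemma norm_matrix_vector_le: "norm (A *v x) \<le> onorm ((*v) A) * norm x"
  for A :: "real ^ 'n ^ 'm"
  by (rule onorm) simp

lemma tendsto_matrix_matrix_mult [tendsto_intros]:
  fixes A :: "'a \<Rightarrow> real ^ 'n ^ 'm" and B :: "'a \<Rightarrow> real ^ 'k ^ 'n"
  assumes "(A \<longlongrightarrow> L) F" "(B \<longlongrightarrow> M) F"
  shows "((\<lambda>x. A x ** B x) \<longlongrightarrow> L ** M) F"
  unfolding matrix_matrix_mult_def by (intro tendsto_intros assms)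

lemma tendsto_transpose [tendsto_intros]:
  fixes A :: "'a \<Rightarrow> real ^ 'n ^ 'm"
  assumes "(A \<longlongrightarrow> L) F"
  shows "((\<lambda>x. transpose (A x)) \<longlongrightarrow> transpose L) F"
  unfolding transpose_def by (intro tendsto_intros assms)

text \<open>The operator norm is at most the sum of the absolute values of the entries, which is
  continuous in the matrix.\<close>

lemma eventually_onorm_le:
  fixes A :: "'a \<Rightarrow> real ^ 'n ^ 'm"
  assumes "(A \<longlongrightarrow> L) F" "0 < e"
  shows "\<forall>\<^sub>F x in F. onorm ((*v) (A x - L)) \<le> e"
proof -
  have "((\<lambda>x. \<Sum>i\<in>UNIV. \<Sum>j\<in>UNIV. \<bar>(A x - L) $ i $ j\<bar>) \<longlongrightarrow> (\<Sum>i\<in>UNIV. \<Sum>j\<in>UNIV. \<bar>(L - L) $ i $ j\<bar>)) F"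
    by (intro tendsto_intros assms)
  then have "\<forall>\<^sub>F x in F. (\<Sum>i\<in>UNIV. \<Sum>j\<in>UNIV. \<bar>(A x - L) $ i $ j\<bar>) < e"
    using assms(2) by (intro order_tendstoD(2)) auto
  then show ?thesis
    by eventually_elim (rule order_trans[OF onorm_le_matrix_component_sum less_imp_le])
qed

section \<open>Norms given by positive definite quadratic forms\<close>

text \<open>With this norm the linearised residual \<open>\<alpha> Q w\<close> is measured as
  \<alpha> times the norm of \<open>w\<close>, without a condition number of \<open>Q\<close>,
  because \<open>Q\<close> is cancelled by its inverse.\<close>

definition energy_norm :: "real ^ 'a ^ 'a \<Rightarrow> real ^ 'a \<Rightarrow> real"
  where "energy_norm Q x = sqrt (x \<bullet> (Q *v x))"

lemma sym_pos_def_nonneg: "sym_pos_def A \<Longrightarrow> 0 \<le> x \<bullet> (A *v x)"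
  by (cases "x = 0") (auto simp: sym_pos_def_def less_imp_le)

lemma sym_pos_def_ker: "sym_pos_def A \<Longrightarrow> A *v x = 0 \<Longrightarrow> x = 0"
  by (force simp: sym_pos_def_def)

lemma sym_pos_def_commute:
  fixes A :: "real ^ 'a ^ 'a"
  assumes "sym_pos_def A"
  shows "x \<bullet> (A *v y) = y \<bullet> (A *v x)"
proof -
  have "x \<bullet> (A *v y) = (transpose A *v x) \<bullet> y" by (simp add: dot_lmul_matrix)
  then show ?thesis using assms by (metis sym_pos_def_def inner_commute)
qed

text \<open>The form attains its minimum over the compact unit sphere; this minimum is positive and
  serves as \<open>c\<close>, and homogeneity carries the bound to all vectors.\<close>

lemma sym_pos_def_coercive:
  fixes A :: "real ^ 'a ^ 'a"
  assumes "sym_pos_def A"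
  obtains c where "0 < c" "\<And>x. c * (norm x)\<^sup>2 \<le> x \<bullet> (A *v x)"
proof -
  have "\<exists>y\<in>sphere 0 1. \<forall>x\<in>sphere 0 1. y \<bullet> (A *v y) \<le> x \<bullet> (A *v x)"
    by (intro continuous_attains_inf) (auto intro!: continuous_intros)
  then obtain y where y: "norm y = 1" "\<And>x. norm x = 1 \<Longrightarrow> y \<bullet> (A *v y) \<le> x \<bullet> (A *v x)"
    by auto
  have "(y \<bullet> (A *v y)) * (norm x)\<^sup>2 \<le> x \<bullet> (A *v x)" for x
  proof (cases "x = 0")
    case False
    then have "y \<bullet> (A *v y) \<le> (x /\<^sub>R norm x) \<bullet> (A *v (x /\<^sub>R norm x))"
      by (intro y) simp
    then show ?thesis
      using False by (simp add: matrix_vector_mult_scaleR field_simps power2_eq_square)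
  qed simp
  moreover have "0 < y \<bullet> (A *v y)"
    using assms y(1) by (cases "y = 0") (auto simp: sym_pos_def_def)
  ultimately show ?thesis using that by blast
qed

context
  fixes Q :: "real ^ 'a ^ 'a"
  assumes Q: "sym_pos_def Q"
begin

lemma energy_norm_nonneg: "0 \<le> energy_norm Q x"
  by (simp add: energy_norm_def sym_pos_def_nonneg[OF Q])

lemma energy_norm_square: "(energy_norm Q x)\<^sup>2 = x \<bullet> (Q *v x)"
  by (simp add: energy_norm_def sym_pos_def_nonneg[OF Q])

lemma energy_norm_eq_0: "energy_norm Q x = 0 \<Longrightarrow> x = 0"
  using Q by (force simp: energy_norm_def sym_pos_def_def)

lemma energy_norm_scaleR: "energy_norm Q (t *\<^sub>R x) = \<bar>t\<bar> * energy_norm Q x"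
  by (simp add: energy_norm_def matrix_vector_mult_scaleR real_sqrt_mult power2_eq_square flip: mult.assoc)

text \<open>The form is nonnegative at \<open>b x - t y\<close> with
  \<open>b = y \<bullet> Q y\<close> and \<open>t = x \<bullet> Q y\<close>; its value there is
  \<open>b\<close> times the wanted difference.\<close>

lemma energy_Cauchy_Schwarz: "x \<bullet> (Q *v y) \<le> energy_norm Q x * energy_norm Q y"
proof (cases "y = 0")
  case False
  define b where "b = y \<bullet> (Q *v y)"
  have b: "0 < b" using False Q by (simp add: b_def sym_pos_def_def)
  define t where "t = x \<bullet> (Q *v y)"
  have "0 \<le> (b *\<^sub>R x - t *\<^sub>R y) \<bullet> (Q *v (b *\<^sub>R x - t *\<^sub>R y))"
    by (rule sym_pos_def_nonneg[OF Q])
  also have "\<dots> = b * (b * (x \<bullet> (Q *v x)) - t\<^sup>2)"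
    using sym_pos_def_commute[OF Q, of y x]
    by (simp add: matrix_vector_mult_diff_distrib matrix_vector_mult_scaleR algebra_simps
        power2_eq_square t_def[symmetric] b_def[symmetric])
  finally have "t\<^sup>2 \<le> (x \<bullet> (Q *v x)) * b"
    using b by (simp add: zero_le_mult_iff mult.commute)
  then have "sqrt (t\<^sup>2) \<le> energy_norm Q x * energy_norm Q y"
    unfolding energy_norm_def real_sqrt_mult[symmetric] b_def by (rule real_sqrt_le_mono)
  then show ?thesis by (simp add: t_def)
qed (simp add: energy_norm_def)

lemma energy_norm_triangle: "energy_norm Q (x + y) \<le> energy_norm Q x + energy_norm Q y"
proof (rule power2_le_imp_le)
  have "(energy_norm Q (x + y))\<^sup>2 = (energy_norm Q x)\<^sup>2 + 2 * (x \<bullet> (Q *v y)) + (energy_norm Q y)\<^sup>2"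
    unfolding energy_norm_square using sym_pos_def_commute[OF Q, of y x]
    by (simp add: matrix_vector_right_distrib inner_simps)
  then show "(energy_norm Q (x + y))\<^sup>2 \<le> (energy_norm Q x + energy_norm Q y)\<^sup>2"
    using energy_Cauchy_Schwarz[of x y] by (simp add: power2_sum)
qed (simp add: energy_norm_nonneg)

end

lemma energy_form_le: "x \<bullet> (Q *v x) \<le> onorm ((*v) Q) * (norm x)\<^sup>2"
  for Q :: "real ^ 'a ^ 'a"
proof -
  have "x \<bullet> (Q *v x) \<le> norm x * norm (Q *v x)" by (rule norm_cauchy_schwarz)
  also have "\<dots> \<le> norm x * (onorm ((*v) Q) * norm x)"
    by (intro mult_left_mono norm_matrix_vector_le) simp
  finally show ?thesis by (simp add: power2_eq_square mult_ac)
qed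

lemma energy_norm_le:
  fixes Q :: "real ^ 'a ^ 'a"
  shows "energy_norm Q x \<le> sqrt (onorm ((*v) Q)) * norm x"
  using real_sqrt_le_mono[OF energy_form_le[of x Q]] by (simp add: energy_norm_def real_sqrt_mult)

lemma energy_norm_ge:
  fixes Q :: "real ^ 'a ^ 'a"
  assumes "sym_pos_def Q"
  obtains c where "0 < c" "\<And>x. norm x \<le> c * energy_norm Q x"
proof -
  obtain s where s: "0 < s" "\<And>x. s * (norm x)\<^sup>2 \<le> x \<bullet> (Q *v x)"
    using sym_pos_def_coercive[OF assms] by blast
  have "sqrt s * norm x \<le> energy_norm Q x" for x
    using real_sqrt_le_mono[OF s(2)[of x]] by (simp add: energy_norm_def real_sqrt_mult)
  then show ?thesis
    using s(1) by (intro that[of "1 / sqrt s"]) (auto simp: field_simps)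
qed

subsection \<open>One regularised Gauss-Newton step\<close>

text \<open>Test the equation \<open>(A + a Q) w = g\<close> with \<open>w\<close>: the left side is
  at least \<open>a + c\<close> times the squared \<open>Q\<close>-norm of \<open>w\<close>. On the
  right, writing \<open>g\<close> as \<open>Q\<close> applied to \<open>matrix_inv Q *v g\<close>
  allows the Cauchy-Schwarz inequality of the same norm.\<close>

lemma regularised_solve:
  fixes A Q :: "real ^ 'q ^ 'q" and g :: "real ^ 'q"
  assumes Q: "sym_pos_def Q" and c: "0 < c" and a: "0 < a"
    and coercive: "\<And>w. c * (w \<bullet> (Q *v w)) \<le> w \<bullet> (A *v w)"
  defines "w \<equiv> matrix_inv (A + a *\<^sub>R Q) *v g"
  shows "g - A *v w = a *\<^sub>R (Q *v w)"
    and "energy_norm Q w \<le> 1 / (a + c) * energy_norm Q (matrix_inv Q *v g)"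
proof -
  have split: "(A + a *\<^sub>R Q) *v x = A *v x + a *\<^sub>R (Q *v x)" for x
    by (simp add: matrix_vector_mult_add_rdistrib scaleR_matrix_vector_assoc)
  have lower: "(c + a) * (x \<bullet> (Q *v x)) \<le> x \<bullet> ((A + a *\<^sub>R Q) *v x)" for x
    unfolding split using coercive[of x] by (simp add: inner_simps algebra_simps)
  have ker: "x = 0" if "(A + a *\<^sub>R Q) *v x = 0" for x
  proof (rule ccontr)
    assume "x \<noteq> 0"
    then have "0 < (c + a) * (x \<bullet> (Q *v x))" using Q c a by (simp add: sym_pos_def_def)
    then show False using lower[of x] that by simp
  qed
  have g: "(A + a *\<^sub>R Q) *v w = g"
    unfolding w_def by (simp only: matrix_vector_mul_assoc matrix_inv_inverse(1)[OF ker] matrix_vector_mul_lid)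
  then show "g - A *v w = a *\<^sub>R (Q *v w)"
    unfolding split by (simp add: algebra_simps)
  let ?n = "energy_norm Q w" and ?v = "matrix_inv Q *v g"
  have Qv: "Q *v ?v = g"
    by (simp only: matrix_vector_mul_assoc matrix_inv_inverse(1)[OF sym_pos_def_ker[OF Q]] matrix_vector_mul_lid)
  have "(c + a) * ?n\<^sup>2 \<le> w \<bullet> (Q *v ?v)"
    using lower[of w] by (simp only: g Qv energy_norm_square[OF Q])
  also have "\<dots> \<le> ?n * energy_norm Q ?v"
    by (rule energy_Cauchy_Schwarz[OF Q])
  finally have "?n * ((c + a) * ?n) \<le> ?n * energy_norm Q ?v"
    by (simp add: power2_eq_square mult_ac)
  then have "(c + a) * ?n \<le> energy_norm Q ?v"
    using energy_norm_nonneg[OF Q, of w] energy_norm_nonneg[OF Q, of ?v]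
    by (cases "?n = 0") auto
  then show "?n \<le> 1 / (a + c) * energy_norm Q ?v"
    using c a by (simp add: field_simps)
qed


text \<open>The form at \<open>w\<close> is that of \<open>S\<close> at
  \<open>transpose D *v w\<close>, which is nonzero since \<open>D\<close> has full row
  rank.\<close>

lemma sym_pos_def_congruence:
  fixes S :: "real ^ 'p ^ 'p" and D :: "real ^ 'p ^ 'q"
  assumes S: "sym_pos_def S" and inj: "\<And>w. transpose D *v w = 0 \<Longrightarrow> w = 0"
  shows "sym_pos_def (D ** S ** transpose D)"
  unfolding sym_pos_def_def
proof (intro conjI allI impI)
  show "transpose (D ** S ** transpose D) = D ** S ** transpose D"
    using S by (simp add: sym_pos_def_def matrix_transpose_mul matrix_mul_assoc)
next
  fix w :: "real ^ 'q" assume "w \<noteq> 0"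
  then have "transpose D *v w \<noteq> 0" using inj by blast
  then have "0 < (transpose D *v w) \<bullet> (S *v (transpose D *v w))"
    using S unfolding sym_pos_def_def by blast
  also have "\<dots> = w \<bullet> ((D ** S ** transpose D) *v w)"
    by (simp add: dot_lmul_matrix flip: matrix_vector_mul_assoc)
  finally show "0 < w \<bullet> ((D ** S ** transpose D) *v w)" .
qed

text \<open>Mean value inequality on the segment from \<open>u\<close> to \<open>u + h\<close>,
  which stays in the convex ball; two values of \<open>D\<close> there differ by at most
  \<open>e / 2 + e / 2\<close>. The bound is uniform in the base point, as the iterates move while
  \<open>p\<close> is fixed.\<close>

lemma strict_derivative_bound:
  fixes g :: "real ^ 'p \<Rightarrow> real ^ 'q" and D :: "real ^ 'p \<Rightarrow> real ^ 'p ^ 'q"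
  assumes "\<And>u. (g has_derivative (*v) (D u)) (at u)"
    and near: "\<And>u. u \<in> ball p r \<Longrightarrow> onorm ((*v) (D u - D p)) \<le> e / 2"
    and u: "u \<in> ball p r" "u + h \<in> ball p r"
  shows "norm (g (u + h) - g u - D u *v h) \<le> e * norm h"
proof -
  have "norm (g (u + h) - g u - D u *v (u + h - u)) \<le> norm (u + h - u) * e"
  proof (rule differentiable_bound_linearization[where S = "ball p r" and f' = "\<lambda>u. (*v) (D u)"])
    show "u + t *\<^sub>R (u + h - u) \<in> ball p r" if "t \<in> {0..1}" for t
    proof -
      have "(1 - t) *\<^sub>R u + t *\<^sub>R (u + h) \<in> ball p r"
        using that by (intro convexD u convex_ball) auto
      then show ?thesis by (simp add: algebra_simps)
    qed
    show "(g has_derivative (*v) (D v)) (at v within ball p r)" for v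
      using assms(1) by (rule has_derivative_at_withinI)
    show "onorm ((*v) (D v) - (*v) (D u)) \<le> e" if v: "v \<in> ball p r" for v
    proof -
      have "(*v) (D v) - (*v) (D u) = (\<lambda>x. (D v - D p) *v x + - ((D u - D p) *v x))"
        by (auto simp: matrix_vector_mult_diff_rdistrib)
      moreover have "onorm (\<lambda>x. (D v - D p) *v x + - ((D u - D p) *v x))
          \<le> onorm ((*v) (D v - D p)) + onorm (\<lambda>x. - ((D u - D p) *v x))"
        by (intro onorm_triangle bounded_linear_minus) auto
      ultimately show ?thesis
        using near[OF v] near[OF u(1)] by (simp add: onorm_neg)
    qed
  qed (use u in auto)
  then show ?thesis by (simp add: mult.commute)
qed

section \<open>Local convergence of the regularised iteration\<close>

text \<open>All constants and radii are fixed at \<open>p\<close> before the parameters \<alpha>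
  enter. The limit need not be \<open>p\<close>; it is only some zero of \<open>g\<close>.\<close>

theorem regularised_Gauss_Newton_converges:
  fixes g :: "real ^ 'p \<Rightarrow> real ^ 'q" and D :: "real ^ 'p \<Rightarrow> real ^ 'p ^ 'q" and \<alpha> :: "nat \<Rightarrow> real"
  assumes g: "\<And>u. (g has_derivative (*v) (D u)) (at u)" and contD: "isCont D p"
    and inj: "\<And>w. transpose (D p) *v w = 0 \<Longrightarrow> w = 0"
    and S: "sym_pos_def S" and Q: "sym_pos_def Q"
    and \<alpha>: "\<And>k. 0 < \<alpha> k" "\<not> summable (\<lambda>k. 1 / \<alpha> k)" and p: "g p = 0"
  obtains e where "0 < e" and "\<And>x. x 0 \<in> ball p e \<Longrightarrow>
      (\<And>k. x (Suc k) = x k - (S ** transpose (D (x k)) **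
          matrix_inv (D (x k) ** S ** transpose (D (x k)) + \<alpha> k *\<^sub>R Q)) *v g (x k)) \<Longrightarrow>
      \<exists>l. x \<longlonglongrightarrow> l \<and> g l = 0"
proof -
  define A where "A u = D u ** S ** transpose (D u)" for u
  define V where "V u = energy_norm Q (matrix_inv Q *v g u)" for u
  have V0: "0 \<le> V u" for u by (simp add: V_def energy_norm_nonneg[OF Q])
  obtain s where s: "0 < s" "\<And>w. s * (norm w)\<^sup>2 \<le> w \<bullet> (A p *v w)"
    using sym_pos_def_coercive[OF sym_pos_def_congruence[OF S inj]] unfolding A_def by blast
  obtain \<kappa> where \<kappa>: "0 < \<kappa>" "\<And>x. norm x \<le> \<kappa> * energy_norm Q x"
    using energy_norm_ge[OF Q] by blast
  \<comment> \<open>Half of the coercivity constant \<open>s\<close> at \<open>p\<close> is left for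
    the variation of \<open>A\<close> over the ball; the denominator passes from the Euclidean norm
    to that of \<open>Q\<close>, with \<open>+ 1\<close> keeping it positive.\<close>
  define c where "c = s / (2 * (onorm ((*v) Q) + 1))"
  have oQ: "0 \<le> onorm ((*v) Q)" by (rule onorm_pos_le) simp
  have c: "0 < c" using s oQ by (simp add: c_def)
  \<comment> \<open>The summand 1 allows for the variation of \<open>S ** transpose (D u)\<close>
    over the ball.\<close>
  define K where "K = onorm ((*v) (S ** transpose (D p))) + 1"
  have K: "0 < K" by (simp add: K_def onorm_pos_le add_nonneg_pos)
  define B where "B = sqrt (onorm ((*v) Q)) * onorm ((*v) (matrix_inv Q)) + 1"
  have B: "0 < B" using oQ by (simp add: B_def onorm_pos_le add_nonneg_pos)
  have Bv: "energy_norm Q (matrix_inv Q *v y) \<le> B * norm y" for y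
  proof -
    have "energy_norm Q (matrix_inv Q *v y) \<le> sqrt (onorm ((*v) Q)) * norm (matrix_inv Q *v y)"
      by (rule energy_norm_le)
    also have "\<dots> \<le> sqrt (onorm ((*v) Q)) * (onorm ((*v) (matrix_inv Q)) * norm y)"
      using oQ by (intro mult_left_mono norm_matrix_vector_le) simp
    also have "\<dots> \<le> B * norm y" by (simp add: B_def algebra_simps)
    finally show ?thesis .
  qed
  \<comment> \<open>Chosen so that a linearisation error of \<open>e\<close> times the step length,
    measured through \<open>B\<close>, costs at most \<open>c / 2 * a k * V (x k)\<close>, half of
    the gain of the linearised step.\<close>
  define e where "e = c / (2 * B * K * \<kappa>)"
  have e: "0 < e" "B * (e * (K * \<kappa>)) = c / 2" using c B K \<kappa> by (auto simp: e_def field_simps)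

  have D: "(D \<longlongrightarrow> D p) (nhds p)"
    using contD by (simp add: isCont_def tendsto_at_iff_tendsto_nhds)
  have "\<forall>\<^sub>F u in nhds p. onorm ((*v) (A u - A p)) \<le> s / 2"
    unfolding A_def using s by (intro eventually_onorm_le tendsto_intros D) auto
  moreover have "\<forall>\<^sub>F u in nhds p. onorm ((*v) (D u - D p)) \<le> e / 2"
    using e by (intro eventually_onorm_le D) auto
  moreover have "\<forall>\<^sub>F u in nhds p. onorm ((*v) (S ** transpose (D u) - S ** transpose (D p))) \<le> 1"
    by (intro eventually_onorm_le tendsto_intros D) auto
  ultimately have "\<forall>\<^sub>F u in nhds p. onorm ((*v) (A u - A p)) \<le> s / 2 \<and> onorm ((*v) (D u - D p)) \<le> e / 2 \<and>
      onorm ((*v) (S ** transpose (D u) - S ** transpose (D p))) \<le> 1"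
    by (intro eventually_conj)
  then obtain r where r: "0 < r" "\<And>u. u \<in> ball p r \<Longrightarrow> onorm ((*v) (A u - A p)) \<le> s / 2"
      "\<And>u. u \<in> ball p r \<Longrightarrow> onorm ((*v) (D u - D p)) \<le> e / 2"
      "\<And>u. u \<in> ball p r \<Longrightarrow> onorm ((*v) (S ** transpose (D u) - S ** transpose (D p))) \<le> 1"
    by (auto simp: eventually_nhds_metric dist_commute)

  have coercive: "c * (w \<bullet> (Q *v w)) \<le> w \<bullet> (A u *v w)" if u: "u \<in> ball p r" for u w
  proof -
    have "c * (w \<bullet> (Q *v w)) \<le> c * (onorm ((*v) Q) * (norm w)\<^sup>2)"
      using c by (intro mult_left_mono energy_form_le) simp
    also have "\<dots> \<le> c * ((onorm ((*v) Q) + 1) * (norm w)\<^sup>2)"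
      using c by (intro mult_left_mono mult_right_mono) auto
    also have "\<dots> = s / 2 * (norm w)\<^sup>2" using oQ by (simp add: c_def divide_simps)
    also have "\<dots> \<le> s * (norm w)\<^sup>2 - onorm ((*v) (A u - A p)) * (norm w)\<^sup>2"
      using mult_right_mono[OF r(2)[OF u], of "(norm w)\<^sup>2"] by simp
    also have "\<dots> \<le> w \<bullet> (A p *v w) - norm w * norm ((A u - A p) *v w)"
      using s(2)[of w] mult_left_mono[OF norm_matrix_vector_le[of "A u - A p" w], of "norm w"]
      by (simp add: power2_eq_square mult_ac)
    also have "\<dots> \<le> w \<bullet> (A p *v w) + w \<bullet> ((A u - A p) *v w)"
      using Cauchy_Schwarz_ineq2[of w "(A u - A p) *v w"] by linarith
    also have "\<dots> = w \<bullet> (A u *v w)"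
      by (simp add: matrix_vector_mult_diff_rdistrib inner_simps)
    finally show ?thesis .
  qed
  have stepK: "norm ((S ** transpose (D u)) *v w) \<le> K * norm w" if u: "u \<in> ball p r" for u w
  proof -
    let ?T = "\<lambda>u. S ** transpose (D u)"
    have "norm (?T u *v w) \<le> norm ((?T u - ?T p) *v w) + norm (?T p *v w)"
      using norm_triangle_ineq[of "(?T u - ?T p) *v w" "?T p *v w"]
      by (simp add: matrix_vector_mult_diff_rdistrib)
    also have "\<dots> \<le> 1 * norm w + onorm ((*v) (?T p)) * norm w"
      by (intro add_mono order_trans[OF norm_matrix_vector_le] mult_right_mono r(4) u) auto
    finally show ?thesis by (simp add: K_def algebra_simps)
  qed

  have contV: "continuous_on UNIV V"
  proof -
    have "continuous_on UNIV g"
      using has_derivative_continuous[OF g] by (auto simp: continuous_on_eq_continuous_at)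
    then show ?thesis
      unfolding V_def energy_norm_def
      by (intro continuous_intros continuous_on_compose2[OF matrix_vector_mult_linear_continuous_on]) auto
  qed
  \<comment> \<open>The left side of the hypothesis \<open>start\<close> of the descent lemma for
    \<open>C = K * \<kappa>\<close> and \<open>\<gamma> = c / 2\<close>. It is continuous and
    vanishes at \<open>p\<close>, so it is below \<open>r\<close> near \<open>p\<close>.\<close>
  define W where "W u = dist p u + K * \<kappa> / (c / 2) * V u" for u
  have "isCont W p"
    unfolding W_def[abs_def] using contV c by (auto simp: continuous_on_eq_continuous_at intro!: continuous_intros)
  moreover have "W p = 0" by (simp add: W_def V_def p energy_norm_def)
  ultimately have "(W \<longlongrightarrow> 0) (nhds p)"
    by (metis isCont_def tendsto_at_iff_tendsto_nhds)
  then have "\<forall>\<^sub>F u in nhds p. W u < r" using r(1) by (rule order_tendstoD)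
  then obtain e' where e': "0 < e'" "\<And>u. u \<in> ball p e' \<Longrightarrow> W u < r"
    by (auto simp: eventually_nhds_metric dist_commute)

  have "\<exists>l. x \<longlonglongrightarrow> l \<and> g l = 0"
    if x0: "x 0 \<in> ball p e'" and x: "\<And>k. x (Suc k) = x k - (S ** transpose (D (x k)) **
          matrix_inv (D (x k) ** S ** transpose (D (x k)) + \<alpha> k *\<^sub>R Q)) *v g (x k)" for x
  proof -
    define w where "w k = matrix_inv (A (x k) + \<alpha> k *\<^sub>R Q) *v g (x k)" for k
    define h where "h k = - ((S ** transpose (D (x k))) *v w k)" for k
    define a where "a k = 1 / (\<alpha> k + c)" for k
    have a: "0 < a k" "c * a k \<le> 1" "\<alpha> k * a k = 1 - c * a k" for k
      using \<alpha>(1)[of k] c by (auto simp: a_def field_simps)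
    have x: "x (Suc k) = x k + h k" for k
      by (simp add: x h_def w_def A_def matrix_vector_mul_assoc del: transpose_matrix_vector)
    have w: "g (x k) - A (x k) *v w k = \<alpha> k *\<^sub>R (Q *v w k)" "energy_norm Q (w k) \<le> a k * V (x k)"
      if "x k \<in> ball p r" for k
      unfolding w_def a_def V_def
      by (rule regularised_solve[OF Q c \<alpha>(1) coercive[OF that]])+
    have h: "norm (h k) \<le> K * \<kappa> * a k * V (x k)" if "x k \<in> ball p r" for k
    proof -
      have "norm (h k) \<le> K * norm (w k)" using stepK[OF that] by (simp add: h_def)
      also have "\<dots> \<le> K * (\<kappa> * (a k * V (x k)))"
        using K \<kappa> w(2)[OF that] by (intro mult_left_mono order_trans[OF \<kappa>(2)]) auto
      finally show ?thesis by (simp add: mult_ac)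
    qed
    have "\<exists>l. x \<longlonglongrightarrow> l \<and> V l = 0"
    proof (rule descent_sequence_converges
        [OF contV V0, where a = a and \<gamma> = "c / 2" and C = "K * \<kappa>" and p = p and r = r])
      show "0 < a k" "c / 2 * a k \<le> 1" for k using a[of k] c by auto
      show "\<not> summable a" unfolding a_def by (rule not_summable_inverse_shift[OF \<alpha> c])
      show "0 < c / 2" "0 \<le> K * \<kappa>" using c K \<kappa> by auto
      show "dist (x k) (x (Suc k)) \<le> K * \<kappa> * a k * V (x k)" if "x k \<in> ball p r" for k
        using h[OF that] by (simp add: x dist_norm)
      show "dist p (x 0) + K * \<kappa> / (c / 2) * V (x 0) < r"
        using e'(2)[OF x0] by (simp add: W_def)
    next
      fix k assume b: "x k \<in> ball p r" "x (Suc k) \<in> ball p r"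
      define err where "err = g (x k + h k) - g (x k) - D (x k) *v h k"
      have "norm err \<le> e * norm (h k)"
        unfolding err_def using b r(3) by (intro strict_derivative_bound[OF g]) (auto simp: x)
      also have "\<dots> \<le> e * (K * \<kappa> * a k * V (x k))"
        using e h[OF b(1)] by simp
      finally have "B * norm err \<le> B * (e * (K * \<kappa> * a k * V (x k)))"
        using B by simp
      then have err: "B * norm err \<le> c / 2 * a k * V (x k)"
        unfolding e(2)[symmetric] by (simp add: mult_ac)
      have "D (x k) *v h k = - (A (x k) *v w k)"
        by (simp add: h_def A_def matrix_vector_mul_assoc matrix_mul_assoc
            linear_neg[OF matrix_vector_mul_linear] del: transpose_matrix_vector)
      \<comment> \<open>The linearised residual is \<alpha> times \<open>Q w\<close>. Pulling
        \<open>Q\<close> out in front prepares its cancellation by \<open>matrix_inv Q\<close>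
        inside \<open>V\<close>.\<close>
      then have "g (x (Suc k)) = Q *v (\<alpha> k *\<^sub>R w k) + err"
        using w(1)[OF b(1)] by (simp add: err_def x matrix_vector_mult_scaleR algebra_simps)
      then have "V (x (Suc k)) = energy_norm Q (\<alpha> k *\<^sub>R w k + matrix_inv Q *v err)"
        unfolding V_def by (simp add: matrix_vector_right_distrib matrix_vector_mul_assoc
            matrix_inv_inverse(2)[OF sym_pos_def_ker[OF Q]])
      also have "\<dots> \<le> energy_norm Q (\<alpha> k *\<^sub>R w k) + energy_norm Q (matrix_inv Q *v err)"
        by (rule energy_norm_triangle[OF Q])
      also have "\<dots> \<le> \<alpha> k * (a k * V (x k)) + c / 2 * a k * V (x k)"
        using \<alpha>(1)[of k] w(2)[OF b(1)] Bv[of err] err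
        by (intro add_mono) (auto simp: energy_norm_scaleR[OF Q])
      \<comment> \<open>By the choice of \<open>a\<close>,
        \<open>\<alpha> k * a k = 1 - c * a k\<close>; the error gives back half of
        \<open>c * a k\<close>.\<close>
      also have "\<dots> = (1 - c / 2 * a k) * V (x k)"
        unfolding mult.assoc[symmetric] distrib_right[symmetric] a(3) by (simp add: algebra_simps)
      finally show "V (x (Suc k)) \<le> (1 - c / 2 * a k) * V (x k)" .
    qed
    then obtain l where l: "x \<longlonglongrightarrow> l" "V l = 0" by blast
    then have "matrix_inv Q *v g l = 0" unfolding V_def by (intro energy_norm_eq_0[OF Q])
    then have "(Q ** matrix_inv Q) *v g l = 0" by (simp flip: matrix_vector_mul_assoc)
    then have "g l = 0" by (simp add: matrix_inv_inverse(1)[OF sym_pos_def_ker[OF Q]])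
    with l show ?thesis by blast
  qed
  with e'(1) show ?thesis by (rule that)
qed


subsection \<open>The discrete model\<close>

lemma pos_less: "pos (k :: 'k::finite) < CARD('k)"
  using bij_betw_pos[where 'k='k] by (auto simp: bij_betw_def)

lemma pos_eq_iff [simp]: "pos (k :: 'k::finite) = pos l \<longleftrightarrow> k = l"
  by (metis at_pos_pos)

section \<open>Block diagonal matrices and positive definiteness of \<Sigma>\<close>

lemma block_blockdiag:
  fixes A :: "'k::finite \<Rightarrow> real ^ 'b::finite ^ 'a::finite"
  shows "block (blockdiag A *v x) k = A k *v block x k"
proof -
  have "(\<Sum>q\<in>UNIV. (if k = fst q then A k $ i $ snd q else 0) * x $ q) =
      (\<Sum>l\<in>UNIV. \<Sum>j\<in>UNIV. (if k = l then A k $ i $ j else 0) * x $ (l, j))" for i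
    unfolding sum.cartesian_product UNIV_Times_UNIV[symmetric] by (simp add: case_prod_beta')
  also have "\<dots> i = (\<Sum>l\<in>UNIV. if k = l then \<Sum>j\<in>UNIV. A k $ i $ j * x $ (l, j) else 0)" for i
    by (intro sum.cong) auto
  finally show ?thesis
    by (simp add: vec_eq_iff block_def blockdiag_def matrix_vector_mult_def cong: if_cong)
qed

lemma inner_block:
  fixes x y :: "real ^ ('k::finite \<times> 'm::finite)"
  shows "x \<bullet> y = (\<Sum>k\<in>UNIV. block x k \<bullet> block y k)"
  unfolding inner_vec_def block_def sum.cartesian_product UNIV_Times_UNIV[symmetric]
  by (simp add: case_prod_beta')

text \<open>The form splits into the sum of the forms of the blocks, all nonnegative, and a nonzero
  vector has a nonzero block.\<close>

lemma sym_pos_def_blockdiag: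
  fixes A :: "'k::finite \<Rightarrow> real ^ 'a::finite ^ 'a"
  assumes "\<And>k. sym_pos_def (A k)"
  shows "sym_pos_def (blockdiag A)"
  unfolding sym_pos_def_def
proof (intro conjI allI impI)
  have "A k $ i $ j = A k $ j $ i" for k i j
  proof -
    have "A k $ i $ j = transpose (A k) $ j $ i" by (simp add: transpose_def)
    then show ?thesis using assms[of k] by (simp add: sym_pos_def_def)
  qed
  then show "transpose (blockdiag A) = blockdiag A"
    by (simp add: transpose_def blockdiag_def vec_eq_iff)
next
  fix x :: "real ^ ('k \<times> 'a)" assume "x \<noteq> 0"
  then obtain k where k: "block x k \<noteq> 0"
    by (auto simp: block_def vec_eq_iff)
  have "0 < (\<Sum>k\<in>UNIV. block x k \<bullet> (A k *v block x k))"
    using k assms by (intro sum_pos2[of _ k] sym_pos_def_nonneg) (auto simp: sym_pos_def_def)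
  then show "0 < x \<bullet> (blockdiag A *v x)"
    by (simp add: inner_block block_blockdiag)
qed

text \<open>A vector in the kernel of \<open>\<Sigma>\<close> satisfies \<open>H x = 0\<close> and \<open>x - H\<^sup>T H x = 0\<close>, hence \<open>x = 0\<close>.\<close>
lemma sym_pos_def_Sigma_mat:
  fixes H :: "real ^ 'p::finite ^ 'q::finite"
  assumes R: "sym_pos_def R" and W: "sym_pos_def W"
  shows "sym_pos_def (Sigma_mat H R W)"
  unfolding sym_pos_def_def
proof (intro conjI allI impI)
  define P where "P = mat 1 - transpose H ** H"
  have P: "transpose P = P"
    by (simp add: P_def transpose_diff matrix_transpose_mul)
  show "transpose (Sigma_mat H R W) = Sigma_mat H R W"
    using R W P unfolding Sigma_mat_def P_def[symmetric]
    by (simp add: transpose_add matrix_transpose_mul sym_pos_def_def matrix_mul_assoc)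
  fix x :: "real ^ 'p" assume x: "x \<noteq> 0"
  have "x \<bullet> ((transpose H ** R ** H) *v x) = (H *v x) \<bullet> (R *v (H *v x))"
    by (metis dot_lmul_matrix matrix_vector_mul_assoc transpose_matrix_vector transpose_transpose)
  moreover have "x \<bullet> ((P ** W ** P) *v x) = (P *v x) \<bullet> (W *v (P *v x))"
    by (metis P dot_lmul_matrix matrix_vector_mul_assoc transpose_matrix_vector)
  ultimately have form: "x \<bullet> (Sigma_mat H R W *v x) =
      (H *v x) \<bullet> (R *v (H *v x)) + (P *v x) \<bullet> (W *v (P *v x))"
    by (simp add: Sigma_mat_def P_def[symmetric] matrix_vector_mult_add_rdistrib inner_simps)
  have "H *v x \<noteq> 0 \<or> P *v x \<noteq> 0"
  proof (rule ccontr)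
    assume "\<not> (H *v x \<noteq> 0 \<or> P *v x \<noteq> 0)"
    then have Hx: "H *v x = 0" and Px: "P *v x = 0" by auto
    have "P *v x = x - transpose H *v (H *v x)"
      unfolding P_def matrix_vector_mult_diff_rdistrib matrix_vector_mul_assoc matrix_vector_mul_lid ..
    then show False using x Hx Px by simp
  qed
  then show "0 < x \<bullet> (Sigma_mat H R W *v x)"
    unfolding form using R W sym_pos_def_nonneg[OF R] sym_pos_def_nonneg[OF W]
    by (auto simp: sym_pos_def_def intro: add_pos_nonneg add_nonneg_pos)
qed

section \<open>Derivative of \<open>G\<close>: existence, continuity and full row rank\<close>

lemma bounded_linear_state: "bounded_linear (\<lambda>u :: ('n::finite, 'm::finite) traj. state u n)"
  unfolding linear_conv_bounded_linear[symmetric]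
  by (rule linearI) (simp_all add: state_def block_def vec_eq_iff)

lemma has_derivative_G:
  fixes u :: "('n::finite, 'm::finite) traj"
  assumes "\<And>n. n < CARD('n) \<Longrightarrow> F n differentiable (at (state u n))"
  shows "(G F has_derivative (*v) (G' F u)) (at u)"
proof -
  have "(\<lambda>v :: ('n, 'm) traj. (state v (Suc n) - F n (state v n)) $ i) differentiable (at u)"
    if "n < CARD('n)" for n i
  proof -
    have st: "(\<lambda>v :: ('n, 'm) traj. state v k) differentiable (at u)" for k
      by (intro bounded_linear_imp_differentiable bounded_linear_state)
    have "(\<lambda>v :: ('n, 'm) traj. F n (state v n)) differentiable (at u)"
      using differentiable_chain_at[OF st assms[OF that]] by (simp add: o_def)
    with st have "(\<lambda>v :: ('n, 'm) traj. state v (Suc n) - F n (state v n)) differentiable (at u)"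
      by (intro differentiable_diff)
    then show ?thesis
      unfolding differentiable_def using bounded_linear.has_derivative[OF bounded_linear_vec_nth] by blast
  qed
  then have "G F differentiable (at u)"
    unfolding differentiable_componentwise_within[of "G F"]
    by (auto simp: Basis_vec_def G_def Let_def inner_axis pos_less)
  then show ?thesis
    unfolding G'_def using jacobian_works by blast
qed

text \<open>Column \<open>j\<close> of the Jacobian is the derivative in the direction
  \<open>axis j 1\<close>, which is of class \<open>C_diff n\<close> and therefore
  continuous.\<close>

lemma C_diff_jacobian:
  fixes f :: "real ^ 'm::finite \<Rightarrow> real ^ 'k::finite"
  assumes "C_diff (Suc n) f"
  shows "f differentiable (at x)" and "continuous_on UNIV (\<lambda>x. jacobian f (at x) $ i $ j)"
proof -
  show "f differentiable (at x)" for x using assms by simp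
  have cont: "C_diff n h \<Longrightarrow> continuous_on UNIV h" for n and h :: "real ^ 'm \<Rightarrow> real ^ 'k"
    by (cases n) (auto intro: differentiable_imp_continuous_on simp: differentiable_on_def)
  have "continuous_on UNIV (\<lambda>x. frechet_derivative f (at x) (axis j 1))"
    using assms by (intro cont[of n]) simp
  then show "continuous_on UNIV (\<lambda>x. jacobian f (at x) $ i $ j)"
    by (auto simp: jacobian_def matrix_def intro: continuous_intros)
qed

text \<open>By the block form, each entry is constant or an entry of the Jacobian of some
  \<open>F n\<close> composed with the linear map \<open>state\<close>.\<close>

lemma isCont_G':
  fixes u :: "('n::finite, 'm::finite) traj"
  assumes "\<And>n. n < CARD('n) \<Longrightarrow> C_diff (Suc r) (F n)"
  shows "isCont (G' F :: ('n, 'm) traj \<Rightarrow> _) u"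
proof -
  have "isCont (\<lambda>u :: ('n, 'm) traj. G' F u $ (s, i) $ (t, j)) u" for s i t j
  proof -
    have "isCont (\<lambda>u :: ('n, 'm) traj. jacobian (F (pos s)) (at (state u (pos s))) $ i $ j) u"
      using C_diff_jacobian(2)[OF assms[OF pos_less]]
      by (intro isCont_o2[OF linear_continuous_at[OF bounded_linear_state]])
        (simp add: continuous_on_eq_continuous_at)
    then show ?thesis
      using C_diff_jacobian(1)[OF assms] by (cases "pos t = pos s") (simp_all add: G'_blocks)
  qed
  then show ?thesis
    unfolding isCont_def by (intro vec_tendstoI) (metis surj_pair)
qed

text \<open>Block column \<open>n+1\<close> contains only the identity in block row \<open>n\<close> and an entry in block row \<open>n+1\<close>,
  so the blocks of \<open>w\<close> vanish by back substitution from the last one.\<close>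
lemma transpose_G'_ker:
  fixes u :: "('n::finite, 'm::finite) traj"
  assumes F: "\<And>n. n < CARD('n) \<Longrightarrow> F n differentiable (at (state u n))"
    and w: "transpose (G' F u) *v w = 0"
  shows "w = 0"
proof -
  have "\<forall>i. w $ (s, i) = 0" for s
  \<comment> \<open>The measure decreases towards the last block row, so the hypothesis covers all
    rows after \<open>s\<close>.\<close>
  proof (induction "CARD('n) - pos s" arbitrary: s rule: less_induct)
    case less
    define t :: "'n option" where "t = at_pos (Suc (pos s))"
    have t: "pos t = Suc (pos s)"
      using pos_less[of s] by (simp add: t_def)
    have later: "w $ (s', i) = 0" if "pos s < pos s'" for s' i
      using less.hyps[of s'] that pos_less[of s'] by auto
    show ?case
    proof
      fix j
      have "(\<Sum>q\<in>UNIV. G' F u $ q $ (t, j) * w $ q) = (transpose (G' F u) *v w) $ (t, j)"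
        by (simp add: matrix_vector_mult_def transpose_def del: transpose_matrix_vector)
      also have "\<dots> = 0" using w by simp
      also have "(\<Sum>q\<in>UNIV. G' F u $ q $ (t, j) * w $ q) = (\<Sum>q\<in>UNIV. if q = (s, j) then w $ (s, j) else 0)"
      proof (intro sum.cong refl)
        fix q :: "'n \<times> 'm"
        obtain s' i where q: "q = (s', i)" by fastforce
        show "G' F u $ q $ (t, j) * w $ q = (if q = (s, j) then w $ (s, j) else 0)"
          using later[of s' i] unfolding q by (auto simp: G'_blocks[OF F] t mat_def)
      qed
      finally show "w $ (s, j) = 0" by simp
    qed
  qed
  then show ?thesis by (simp add: vec_eq_iff split_paired_all)
qed

section \<open>Convergence near the orbit manifold\<close>

text \<open>"Sufficiently near" is expressed by an open neighbourhood: the admissible radius is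
  obtained for each orbit separately, with no uniform lower bound claimed.\<close>

theorem corollary3p4:
  fixes F :: "nat \<Rightarrow> real ^ 'm::finite \<Rightarrow> real ^ 'm"
    and H :: "nat \<Rightarrow> real ^ 'm ^ 'd::finite"
    and R :: "nat \<Rightarrow> real ^ 'd ^ 'd"
    and W :: "nat \<Rightarrow> real ^ 'm ^ 'm"
    and Q :: "nat \<Rightarrow> real ^ 'm ^ 'm"
    and Hb :: "real ^ ('n::finite option \<times> 'm) ^ ('n option \<times> 'd)"
    and S :: "real ^ ('n option \<times> 'm) ^ ('n option \<times> 'm)"
    and Qb :: "real ^ ('n \<times> 'm) ^ ('n \<times> 'm)"
    and \<alpha> :: "nat \<Rightarrow> real"
  assumes "CARD('d) \<le> CARD('m)"
    and "\<And>n. n < CARD('n) \<Longrightarrow> C_diff 3 (F n)"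
    and "\<not> (\<forall>n\<le>CARD('n). is_identity (H n))"
    and "\<And>n. n \<le> CARD('n) \<Longrightarrow> sym_pos_def (R n)"
    and "\<And>n. n \<le> CARD('n) \<Longrightarrow> sym_pos_def (W n)"
    and "\<And>n. 1 \<le> n \<Longrightarrow> n \<le> CARD('n) \<Longrightarrow> sym_pos_def (Q n)"
    and "Hb = time_blockdiag H"
    and "S = Sigma_mat Hb (time_blockdiag R) (time_blockdiag W)"
    and "Qb = step_blockdiag Q"
    and "\<And>k. 0 < \<alpha> k"
    and "\<not> summable (\<lambda>k. 1 / \<alpha> k)"
  shows "\<exists>U. open U \<and> orbit_manifold F \<subseteq> U \<and>
           (\<forall>u0\<in>U. \<exists>u\<in>orbit_manifold F. phi_iter F S Qb \<alpha> u0 \<longlonglongrightarrow> u)"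
proof -
  have F: "F n differentiable (at x)" if "n < CARD('n)" for n x
    using assms(2)[OF that] by (simp add: eval_nat_numeral)
  have C: "C_diff (Suc 2) (F n)" if "n < CARD('n)" for n
    using assms(2)[OF that] by (simp add: eval_nat_numeral)
  have le: "pos (k :: 'n option) \<le> CARD('n)" for k
    using pos_less[of k] by simp
  have S: "sym_pos_def S"
    unfolding assms(8) time_blockdiag_def
    by (intro sym_pos_def_Sigma_mat sym_pos_def_blockdiag assms(4,5) le)
  have Q: "sym_pos_def Qb"
    unfolding assms(9) step_blockdiag_def
    by (intro sym_pos_def_blockdiag assms(6)) (auto simp: Suc_le_eq pos_less)
  have "\<exists>e>0. \<forall>u0\<in>ball p e. \<exists>u\<in>orbit_manifold F. phi_iter F S Qb \<alpha> u0 \<longlonglongrightarrow> u"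
    if "p \<in> orbit_manifold F" for p :: "('n, 'm) traj"
  proof -
    have p: "G F p = 0" using that by (simp add: orbit_manifold_def)
    show ?thesis
    proof (rule regularised_Gauss_Newton_converges
          [where g = "G F :: ('n, 'm) traj \<Rightarrow> _" and D = "G' F" and p = p and S = S and Q = Qb and \<alpha> = \<alpha>])
      show "(G F has_derivative (*v) (G' F u)) (at u)" for u :: "('n, 'm) traj"
        by (intro has_derivative_G F)
      show "isCont (G' F) p" by (rule isCont_G'[OF C])
      show "w = 0" if "transpose (G' F p) *v w = 0" for w
        by (rule transpose_G'_ker[OF F that])
    next
      fix e :: real
      assume e: "0 < e" and conv: "\<And>x. x 0 \<in> ball p e \<Longrightarrow>
        (\<And>k. x (Suc k) = x k - (S ** transpose (G' F (x k)) **
          matrix_inv (G' F (x k) ** S ** transpose (G' F (x k)) + \<alpha> k *\<^sub>R Qb)) *v G F (x k)) \<Longrightarrow>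
        \<exists>l. x \<longlonglongrightarrow> l \<and> G F l = 0"
      have "\<exists>u\<in>orbit_manifold F. phi_iter F S Qb \<alpha> u0 \<longlonglongrightarrow> u" if "u0 \<in> ball p e" for u0
        using conv[of "phi_iter F S Qb \<alpha> u0"] that by (auto simp: phi_def orbit_manifold_def)
      with e show ?thesis by blast
    qed (use S Q assms(10,11) p in auto)
  qed
  then obtain e where e: "\<And>p. p \<in> orbit_manifold F \<Longrightarrow> 0 < e p \<and>
      (\<forall>u0\<in>ball p (e p). \<exists>u\<in>orbit_manifold F. phi_iter F S Qb \<alpha> u0 \<longlonglongrightarrow> u)"
    by metis
  show ?thesis
    \<comment> \<open>The neighbourhood is the union of the balls with the radii chosen for the
      individual orbits.\<close>
    using e by (intro exI[of _ "\<Union>p\<in>orbit_manifold F. ball p (e p)"]) force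
qed

end
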